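(* Let $n,C,\tau\in\mathbb Z_{\ge1}$ and $q\in[0,1)^n$. Suppose that either (Salvo) $q_1=q_2=\cdots=q_n$, or (Two-unit capacity) $C\le2$. Then every fair allocation policy $\pi_{\mathsf{FA}}\in\Pi_{\mathsf{FA}}$ is optimal for all three problems: it attains $\min_{\pi\in\Pi}\mathbb E[T^\pi]$ (problem $\mathsf{DTM}$), $\max_{\pi\in\Pi}V^\pi_{\mathsf{SLM}_\tau}$ (problem $\mathsf{SLM}_\tau$), and $\max_{\pi\in\Pi}V^\pi_{\mathsf{EAM}_\tau}$ (problem $\mathsf{EAM}_\tau$).
   Context: Model. An instance has $n\ge1$ threats $[n]=\{1,\dots,n\}$, a per-round capacity $C\in\mathbb Z_{\ge1}$ of effectors, and difficulties $q=(q_i)\in[0,1)^n$, where $q_i$ is the probability that a single effector fails to neutralize threat $i$. Demands $L_1,\dots,L_n$ are independent, $L_i\sim\mathrm{Geom}(1-q_i)$ on $\{1,2,\dots\}$, i.e. $\Pr(L_i>k)=q_i^k$ (with $0^0=1$). $\mathcal M_t\subseteq[n]$ is the set of active threats at the start of round $t$, $\mathcal M_1=[n]$. A policy is $\pi=(\pi_t)_{t\ge1}$, where $\pi_t$ maps each subset $\mathcal M\subseteq[n]$ to a vector $\pi_t(\mathcal M)\in\mathbb Z_{\ge0}^n$ with $\sum_{i\in[n]}[\pi_t(\mathcal M)]_i\le C$ and, for every nonempty $\mathcal M$ and every $t$, $\sum_{i\in\mathcal M}[\pi_t(\mathcal M)]_i=C$; $\Pi$ is the set of all such policies. Under $\pi$,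 the round-$t$ allocation is $x^t=\pi_t(\mathcal M_t)$ and $\mathcal M_{t+1}=\{i\in\mathcal M_t:\sum_{\ell=1}^t x_i^\ell<L_i\}$ (equivalently, given $\mathcal M_t$ each $i\in\mathcal M_t$ survives round $t$ independently with probability $q_i^{x_i^t}$). Objectives. $T^\pi=\min\{t:\sum_{\ell=1}^t x_i^\ell\ge L_i\ \forall i\in[n]\}$ (defusing time); $V^\pi_{\mathsf{SLM}_\tau}=\Pr(T^\pi\le\tau)$; $V^\pi_{\mathsf{EAM}_\tau}=\mathbb E\big[\sum_{i=1}^n\min\{\sum_{t=1}^\tau x_i^t,L_i\}\big]$. Fair allocation. For nonempty $\mathcal M\subseteq[n]$, $x\in\mathbb Z_{\ge0}^n$ is fair for $\mathcal M$ if $\sum_{i\in\mathcal M}x_i=C$, $x_i=0$ for $i\notin\mathcal M$, and $|x_i-x_j|\in\{0,1\}$ for all $i,j\in\mathcal M$. $\Pi_{\mathsf{FA}}$ is the set of $\pi\in\Pi$ such that $\pi_t(\mathcal M)$ is fair for $\mathcal M$ for every nonempty $\mathcal M\subseteq[n]$ and every $t\ge1$. *)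

theory Defs
  imports "HOL-Probability.Probability" "HOL-Library.Extended_Nat"
begin

text \<open>
  Threats are the elements of \<open>{1..n}\<close> and rounds are numbered from \<open>1\<close>.  A vector indexed by the
  threats is a function on \<open>nat\<close> of which only the values on \<open>{1..n}\<close> matter.  A policy \<open>\<pi>\<close> allocates
  \<open>\<pi> t M i\<close> effectors to threat \<open>i\<close> in round \<open>t\<close> when \<open>M\<close> is the set of active threats.
\<close>

type_synonym policy = "nat \<Rightarrow> nat set \<Rightarrow> nat \<Rightarrow> nat"

text \<open>
  \<open>geometric_pmf p\<close> counts failures and lives on \<open>{0, 1, \<dots>}\<close>, hence the shift by \<open>Suc\<close>.  The function
  returned by \<open>Pi_pmf\<close> has independent components on \<open>{1..n}\<close> and is constantly \<open>0\<close> elsewhere.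
\<close>

definition demands :: "nat \<Rightarrow> (nat \<Rightarrow> real) \<Rightarrow> (nat \<Rightarrow> nat) pmf" where
  "demands n q = Pi_pmf {1..n} 0 (\<lambda>i. map_pmf Suc (geometric_pmf (1 - q i)))"

lemma demands_tail:
  assumes "i \<in> {1..n}" "0 \<le> q i" "q i < 1"
  shows "measure_pmf.prob (demands n q) {L. L i > k} = q i ^ k"
proof -
  let ?g = "geometric_pmf (1 - q i)"
  have comp: "map_pmf (\<lambda>L. L i) (demands n q) = map_pmf Suc ?g"
    using assms unfolding demands_def by (subst Pi_pmf_component) auto
  have "measure_pmf.prob (demands n q) {L. L i > k}
      = measure_pmf.prob (map_pmf (\<lambda>L. L i) (demands n q)) {k<..}"
    by (simp add: vimage_def)
  also have "\<dots> = measure_pmf.prob ?g {k..}"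
    unfolding comp by (simp add: vimage_def less_Suc_eq_le atLeast_def)
  also have "\<dots> = 1 - measure_pmf.prob ?g {..<k}"
    using measure_pmf.prob_compl[of "{..<k}" ?g] by (simp add: Compl_eq_Diff_UNIV[symmetric])
  also have "measure_pmf.prob ?g {..<k} = (\<Sum>j<k. q i ^ j * (1 - q i))"
    using assms by (simp add: measure_measure_pmf_finite)
  also have "1 - \<dots> = q i ^ k"
    by (induction k) (auto simp: algebra_simps)
  finally show ?thesis .
qed

lemma demands_indep:
  "prob_space.indep_vars (measure_pmf (demands n q)) (\<lambda>_. count_space UNIV) (\<lambda>i L. L i) {1..n}"
  unfolding demands_def by (rule indep_vars_Pi_pmf) simp

definition policies :: "nat \<Rightarrow> nat \<Rightarrow> policy set" where
  "policies n C = {\<pi>. \<forall>t\<ge>1. \<forall>M\<subseteq>{1..n}.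
     (\<Sum>i\<in>{1..n}. \<pi> t M i) \<le> C \<and> (M \<noteq> {} \<longrightarrow> (\<Sum>i\<in>M. \<pi> t M i) = C)}"

definition fair :: "nat \<Rightarrow> nat \<Rightarrow> nat set \<Rightarrow> (nat \<Rightarrow> nat) \<Rightarrow> bool" where
  "fair n C M x \<longleftrightarrow>
     (\<Sum>i\<in>M. x i) = C \<and> (\<forall>i\<in>{1..n} - M. x i = 0) \<and>
     (\<forall>i\<in>M. \<forall>j\<in>M. \<bar>int (x i) - int (x j)\<bar> \<in> {0, 1})"

definition fair_policies :: "nat \<Rightarrow> nat \<Rightarrow> policy set" where
  "fair_policies n C =
     {\<pi> \<in> policies n C. \<forall>t\<ge>1. \<forall>M\<subseteq>{1..n}. M \<noteq> {} \<longrightarrow> fair n C M (\<pi> t M)}"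

text \<open>
  The set of threats active at the start of round \<open>t\<close> when the realised demands are \<open>L\<close>.  There is no
  round \<open>0\<close>; the value given there is never used.
\<close>

context
  notes sum.cong [fundef_cong]
begin

fun active :: "nat \<Rightarrow> policy \<Rightarrow> (nat \<Rightarrow> nat) \<Rightarrow> nat \<Rightarrow> nat set" where
  "active n \<pi> L 0 = {1..n}"
| "active n \<pi> L (Suc 0) = {1..n}"
| "active n \<pi> L (Suc (Suc t)) =
     {i \<in> active n \<pi> L (Suc t). (\<Sum>l\<in>{1..Suc t}. \<pi> l (active n \<pi> L l) i) < L i}"

end

definition alloc :: "nat \<Rightarrow> policy \<Rightarrow> (nat \<Rightarrow> nat) \<Rightarrow> nat \<Rightarrow> nat \<Rightarrow> nat" where
  "alloc n \<pi> L t i = \<pi> t (active n \<pi> L t) i"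

text \<open>The infimum is \<open>\<infinity>\<close> if the threats are never all neutralised.\<close>

definition defusing_time :: "nat \<Rightarrow> policy \<Rightarrow> (nat \<Rightarrow> nat) \<Rightarrow> enat" where
  "defusing_time n \<pi> L =
     Inf {enat t | t. t \<ge> 1 \<and> (\<forall>i\<in>{1..n}. L i \<le> (\<Sum>l\<in>{1..t}. alloc n \<pi> L l i))}"

definition DTM :: "nat \<Rightarrow> (nat \<Rightarrow> real) \<Rightarrow> policy \<Rightarrow> ennreal" where
  "DTM n q \<pi> = (\<integral>\<^sup>+ L. ennreal_of_enat (defusing_time n \<pi> L) \<partial>measure_pmf (demands n q))"

definition SLM :: "nat \<Rightarrow> (nat \<Rightarrow> real) \<Rightarrow> nat \<Rightarrow> policy \<Rightarrow> real" where
  "SLM n q \<tau> \<pi> = measure_pmf.prob (demands n q) {L. defusing_time n \<pi> L \<le> enat \<tau>}"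

definition EAM :: "nat \<Rightarrow> (nat \<Rightarrow> real) \<Rightarrow> nat \<Rightarrow> policy \<Rightarrow> real" where
  "EAM n q \<tau> \<pi> = measure_pmf.expectation (demands n q)
     (\<lambda>L. \<Sum>i\<in>{1..n}. real (min (\<Sum>t\<in>{1..\<tau>}. alloc n \<pi> L t i) (L i)))"

end

theory Submission
  imports Defs
begin

text \<open>
  If \<open>C \<le> 2\<close>, then the claim holds for every realisation of the demands: under a fair policy no
  effector is wasted before the round in which the last threat disappears, so as long as some threat
  is active after \<open>\<tau>\<close> rounds, \<open>C * \<tau>\<close> units of demand have been served, and no policy can serve more.

  If all \<open>q i\<close> agree, then, since geometric demands have no memory, the active set is a Markov chain,
  and given the active set the residual demands are again independent and geometric.  The number of
  survivors of a round is a sum of independent Bernoulli variables with parameters \<open>q ^ x i\<close>.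
  Balancing two entries \<open>a + 2 \<le> b\<close> keeps the probability \<open>q ^ (a + b)\<close> that both threats survive
  and by convexity lowers the probability that at least one does; so does merging two threats into one.
  Hence a fair allocation to fewer threats has stochastically fewer survivors than any allocation to at
  least as many threats, and the chains of a fair policy and of any other policy can be coupled
  such that the fair one never has more active threats.  Since the total demand is served demand plus
  residual demand, and the mean of the latter is proportional to the mean number of active threats,
  all objectives follow from this coupling.
\<close>

subsection \<open>Sums of independent Bernoulli variables\<close>

lemma map_pmf_conj: "map_pmf ((\<and>) b) p = (if b then p else return_pmf False)"
  by (cases b) (auto simp: map_pmf_const cong: map_pmf_cong)

text \<open>Thinning coupling: draw \<open>b\<close> with parameter \<open>r\<close> and keep it
  with probability \<open>p / r\<close>. The thinned coin \<open>b \<and> c\<close> has parameter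
  \<open>p\<close> and implies \<open>b\<close>.\<close>

lemma rel_pmf_bernoulli:
  assumes "0 \<le> p" "p \<le> r" "r \<le> 1"
  shows "rel_pmf (\<longrightarrow>) (bernoulli_pmf p) (bernoulli_pmf r)"
proof -
  define pq where "pq = bernoulli_pmf r \<bind> (\<lambda>b. map_pmf (\<lambda>c. (b \<and> c, b)) (bernoulli_pmf (p / r)))"
  \<comment> \<open>For \<open>r = 0\<close> also \<open>p = 0\<close>, and the claims hold because
    division by zero yields zero.\<close>
  have *: "0 \<le> p / r" "p / r \<le> 1" "p / r * r = p"
    using assms by (auto simp: divide_simps)
  have "map_pmf fst pq = bernoulli_pmf p"
  proof (rule pmf_eqI)
    fix b
    have "pmf (map_pmf fst pq) True = p"
      using assms * by (simp add: pq_def map_bind_pmf pmf.map_comp o_def pmf_bind map_pmf_conj)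
    then show "pmf (map_pmf fst pq) b = pmf (bernoulli_pmf p) b"
      using assms by (cases b) (auto simp: pmf_False_conv_True)
  qed
  moreover have "map_pmf snd pq = bernoulli_pmf r"
    by (simp add: pq_def map_bind_pmf pmf.map_comp o_def map_pmf_const bind_return_pmf')
  moreover have "\<And>x y. (x, y) \<in> set_pmf pq \<Longrightarrow> x \<longrightarrow> y"
    by (auto simp: pq_def)
  ultimately show ?thesis by (intro rel_pmf.intros)
qed

lemma bernoulli_pmf_1: "bernoulli_pmf 1 = return_pmf True"
  by (rule pmf_eqI) (auto simp: indicator_def split: bool.split)

lemma bernoulli_pmf_mult:
  assumes "0 \<le> p" "p \<le> 1" "0 \<le> r" "r \<le> 1"
  shows "bernoulli_pmf (p * r) = bernoulli_pmf p \<bind> (\<lambda>b. map_pmf ((\<and>) b) (bernoulli_pmf r))"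
    (is "?l = ?r")
proof (rule pmf_eqI)
  fix b
  have "pmf ?r True = p * r"
    using assms by (simp add: pmf_bind map_pmf_conj)
  then show "pmf ?l b = pmf ?r b"
    using assms by (cases b) (auto simp: pmf_False_conv_True mult_le_one)
qed

lemma bernoulli_pmf_compl:
  assumes "0 \<le> p" "p \<le> 1"
  shows "bernoulli_pmf (1 - p) = map_pmf Not (bernoulli_pmf p)"
proof (rule pmf_eqI)
  fix b
  have "pmf (map_pmf Not (bernoulli_pmf p)) (Not (\<not> b)) = pmf (bernoulli_pmf p) (\<not> b)"
    by (rule pmf_map_inj') (simp add: inj_def)
  then show "pmf (bernoulli_pmf (1 - p)) b = pmf (map_pmf Not (bernoulli_pmf p)) b"
    using assms by (cases b) auto
qed

text \<open>The Poisson binomial law of the number of surviving threats. A multiset suffices, since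
  the count depends on the allocated amounts and not on which threat receives them.\<close>

definition survivors :: "real \<Rightarrow> nat multiset \<Rightarrow> nat pmf" where
  "survivors q X = fold_mset
     (\<lambda>x P. bernoulli_pmf (q ^ x) \<bind> (\<lambda>b. map_pmf ((+) (of_bool b)) P)) (return_pmf 0) X"

lemma survivors_empty [simp]: "survivors q {#} = return_pmf 0"
  by (simp add: survivors_def)

text \<open>\<open>fold_mset\<close> unfolds only for a commuting operation; here this is the
  exchange of two independent coin tosses.\<close>

lemma survivors_add_mset [simp]:
  "survivors q (add_mset x X) =
     bernoulli_pmf (q ^ x) \<bind> (\<lambda>b. map_pmf ((+) (of_bool b)) (survivors q X))"
proof -
  interpret comp_fun_commute
    "\<lambda>x P. bernoulli_pmf (q ^ x) \<bind> (\<lambda>b. map_pmf ((+) (of_bool b)) P) :: nat pmf"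
  proof
    fix x y :: nat
    have "bernoulli_pmf (q ^ y) \<bind> (\<lambda>b. bernoulli_pmf (q ^ x) \<bind>
          (\<lambda>c. map_pmf (\<lambda>n. of_bool b + (of_bool c + n)) P))
        = bernoulli_pmf (q ^ x) \<bind> (\<lambda>c. bernoulli_pmf (q ^ y) \<bind>
          (\<lambda>b. map_pmf (\<lambda>n. of_bool c + (of_bool b + n)) P))" for P :: "nat pmf"
      by (subst bind_commute_pmf) (simp add: add.left_commute)
    then show "(\<lambda>P. bernoulli_pmf (q ^ y) \<bind> (\<lambda>b. map_pmf ((+) (of_bool b)) P)) \<circ>
        (\<lambda>P. bernoulli_pmf (q ^ x) \<bind> (\<lambda>b. map_pmf ((+) (of_bool b)) P)) =
        (\<lambda>P. bernoulli_pmf (q ^ x) \<bind> (\<lambda>b. map_pmf ((+) (of_bool b)) P)) \<circ>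
        (\<lambda>P. bernoulli_pmf (q ^ y) \<bind> (\<lambda>b. map_pmf ((+) (of_bool b)) (P :: nat pmf)))"
      by (simp add: fun_eq_iff map_bind_pmf pmf.map_comp o_def)
  qed
  show ?thesis by (simp add: survivors_def)
qed

lemma survivors_union:
  "survivors q (X + Y) = survivors q X \<bind> (\<lambda>k. map_pmf ((+) k) (survivors q Y))"
  by (induction X)
     (auto simp: bind_return_pmf bind_assoc_pmf map_bind_pmf bind_map_pmf pmf.map_comp o_def
        add.assoc cong: map_pmf_cong)

section \<open>Stochastic order of survivor counts under merging and balancing\<close>

lemma rel_pmf_le_trans:
  fixes p :: "nat pmf"
  assumes "rel_pmf (\<le>) p r" "rel_pmf (\<le>) r s"
  shows "rel_pmf (\<le>) p s"
proof -
  have "rel_pmf ((\<le>) OO (\<le>)) p s"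
    using assms by (auto simp: pmf.rel_compp)
  then show ?thesis by (rule pmf.rel_mono_strong) auto
qed

text \<open>Adding the same independent summand preserves the stochastic order, so merging and
  balancing need only be checked on the one or two entries that change.\<close>

lemma survivors_union_mono:
  assumes "rel_pmf (\<le>) (survivors q X) (survivors q X')"
  shows "rel_pmf (\<le>) (survivors q (X + Y)) (survivors q (X' + Y))"
  unfolding survivors_union
  by (rule rel_pmf_bindI[OF assms]) (auto simp: pmf.rel_map intro: rel_pmf_reflI)

context
  fixes q :: real
  assumes q: "0 \<le> q" "q < 1"
begin

lemma power_le1: "q ^ k \<le> 1" "0 \<le> q ^ k"
  using q by (auto intro: power_le_one)

text \<open>Since \<open>q ^ (a + b) = q ^ a * q ^ b\<close>, the merged threat can be made to
  survive exactly when both separate threats do; the same two coins drive both sides.\<close>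

lemma survivors_merge:
  "rel_pmf (\<le>) (survivors q (add_mset (a + b) X)) (survivors q (add_mset a (add_mset b X)))"
proof -
  have "rel_pmf (\<le>) (survivors q {#a + b#}) (survivors q {#a, b#})"
    by (auto simp: power_add bernoulli_pmf_mult power_le1 bind_assoc_pmf map_bind_pmf bind_map_pmf
        bind_return_pmf pmf.map_comp o_def map_pmf_def
        intro!: rel_pmf_bindI[OF rel_pmf_reflI[of _ "(=)"]])
  from survivors_union_mono[OF this, of X] show ?thesis by simp
qed

text \<open>
  Here \<open>t\<close> is the probability that exactly one of the two threats survives, given that not both do.
\<close>

lemma survivors_pair:
  assumes "a + b > 0"
  defines "t \<equiv> (q ^ a + q ^ b - 2 * q ^ (a + b)) / (1 - q ^ (a + b))"
  shows "0 \<le> t" "t \<le> 1" "survivors q {#a, b#} =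
    bernoulli_pmf (q ^ (a + b)) \<bind> (\<lambda>c. if c then return_pmf 2 else map_pmf of_bool (bernoulli_pmf t))"
    (is "?l = ?r")
proof -
  have lt: "q ^ (a + b) < 1"
    using q assms(1) by (metis less_eq_real_def power_0_left power_less_one_iff zero_less_one not_gr0)
  have ab: "q ^ (a + b) = q ^ a * q ^ b"
    by (rule power_add)
  \<comment> \<open>The last inequality says that the probability of no survivor is nonnegative; it
    gives \<open>t \<le> 1\<close>. The other two give \<open>0 \<le> t\<close>.\<close>
  have "q ^ (a + b) \<le> q ^ a" "q ^ (a + b) \<le> q ^ b" "0 \<le> (1 - q ^ a) * (1 - q ^ b)"
    using power_le1 by (auto simp: ab mult_left_le mult_left_le_one_le)
  then show t: "0 \<le> t" "t \<le> 1"
    using lt by (auto simp: t_def field_simps ab)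
  have tt: "(1 - q ^ (a + b)) * t = q ^ a + q ^ b - 2 * q ^ (a + b)"
    using lt by (simp add: t_def)
  show "?l = ?r"
  proof (rule pmf_eqI)
    fix k :: nat
    have inj: "inj (of_bool :: bool \<Rightarrow> nat)" by (auto simp: inj_def)
    have 0: "pmf (map_pmf of_bool (bernoulli_pmf p)) (0::nat) = 1 - p"
      and 1: "pmf (map_pmf of_bool (bernoulli_pmf p)) (Suc 0) = p" if "0 \<le> p" "p \<le> 1" for p :: real
      using pmf_map_inj'[OF inj, of "bernoulli_pmf p" False] that
        pmf_map_inj'[OF inj, of "bernoulli_pmf p" True] by auto
    have m: "pmf (map_pmf of_bool (bernoulli_pmf p)) k = 
      (if k = 0 then 1 - p else if k = 1 then p else 0)" if "0 \<le> p" "p \<le> 1" for p and k :: nat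
      using 0[OF that] 1[OF that] by (auto simp: pmf_eq_0_set_pmf)
    have s: "pmf (map_pmf (\<lambda>x. Suc (of_bool x)) (bernoulli_pmf p)) k = 
      (if k = 0 then 0 else if k = 1 then 1 - p else if k = 2 then p else 0)" if "0 \<le> p" "p \<le> 1" for p k
    proof (cases k)
      case 0
      then show ?thesis by (auto simp: pmf_eq_0_set_pmf)
    next
      case (Suc j)
      have "map_pmf (\<lambda>x. Suc (of_bool x)) (bernoulli_pmf p) = map_pmf Suc (map_pmf of_bool (bernoulli_pmf p))"
        by (simp add: pmf.map_comp o_def)
      then show ?thesis using m[OF that, of j] Suc by (auto simp: pmf_map_inj')
    qed
    have "k = 0 \<or> k = 1 \<or> k = 2 \<or> k > 2" by auto
    then show "pmf ?l k = pmf ?r k"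
      using tt t lt
      by (auto simp: pmf_bind power_le1 power_le1[of "a + b", unfolded ab] m s pmf.map_comp o_def map_bind_pmf bind_return_pmf map_pmf_def[symmetric]
         algebra_simps ab)
  qed
qed

text \<open>Both pairs have sum \<open>a + b\<close>, so the event that both threats survive can be
  shared. On its complement \<open>survivors_pair\<close> leaves a single coin, whose parameter is
  smaller for the balanced pair.\<close>

lemma survivors_balance:
  assumes "a + 2 \<le> b"
  shows "rel_pmf (\<le>) (survivors q (add_mset (a + 1) (add_mset (b - 1) X)))
                     (survivors q (add_mset a (add_mset b X)))"
proof -
  have pos: "a + b > 0" "(a + 1) + (b - 1) > 0" and eq: "(a + 1) + (b - 1) = a + b"
    using assms by auto
  obtain d where d: "b = a + 1 + d"
    using assms by (metis add.assoc le_add_diff_inverse2 add.commute less_imp_le_nat nat_add_left_cancel_le one_add_one order.trans one_le_numeral)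
  have "q ^ (a + 1) + q ^ (b - 1) - 2 * q ^ (a + b) \<le> q ^ a + q ^ b - 2 * q ^ (a + b)"
  proof -
    \<comment> \<open>With \<open>b = a + 1 + d\<close> this product is
      \<open>q ^ a + q ^ b - q ^ (a + 1) - q ^ (b - 1)\<close>: convexity of the
      exponential.\<close>
    have "0 \<le> q ^ a * ((1 - q) * (1 - q ^ d))"
      using q power_le1 by simp
    then show ?thesis by (simp add: d power_add algebra_simps)
  qed
  then have le: "(q ^ (a + 1) + q ^ (b - 1) - 2 * q ^ (a + b)) / (1 - q ^ (a + b))
     \<le> (q ^ a + q ^ b - 2 * q ^ (a + b)) / (1 - q ^ (a + b))"
    using power_le1 by (intro divide_right_mono) auto
  note p1 = survivors_pair[OF pos(1)] and p2 = survivors_pair[OF pos(2), unfolded eq]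
  have "rel_pmf (\<le>) (survivors q {#a + 1, b - 1#}) (survivors q {#a, b#})"
    unfolding p1(3) p2(3)
  proof (rule rel_pmf_bindI[OF rel_pmf_reflI[of _ "(=)"]])
    fix c c' :: bool
    assume "c = c'"
    then show "rel_pmf (\<le>)
      (if c then return_pmf 2 else map_pmf of_bool (bernoulli_pmf
        ((q ^ (a + 1) + q ^ (b - 1) - 2 * q ^ (a + b)) / (1 - q ^ (a + b)))))
      (if c' then return_pmf (2 :: nat) else map_pmf of_bool (bernoulli_pmf
        ((q ^ a + q ^ b - 2 * q ^ (a + b)) / (1 - q ^ (a + b)))))"
      using pmf.rel_mono_strong[OF rel_pmf_bernoulli[OF p2(1) le p1(2)],
          of "\<lambda>x y. of_bool x \<le> (of_bool y :: nat)"]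
      by (cases c) (simp_all only: if_True if_False pmf.rel_map rel_return_pmf of_bool_eq_iff, auto)
  qed simp
  from survivors_union_mono[OF this, of X] show ?thesis by simp
qed
end

section \<open>Balanced multisets have the fewest survivors\<close>

definition balanced :: "nat multiset \<Rightarrow> bool" where
  "balanced X \<longleftrightarrow> (\<forall>x\<in>#X. \<forall>y\<in>#X. x \<le> y + 1)"

text \<open>A balanced multiset has at most two values, \<open>k\<close> and \<open>k + 1\<close>.
  Dividing its sum by its size gives \<open>k\<close> as quotient and the multiplicity of
  \<open>k + 1\<close> as remainder.\<close>

lemma balanced_unique:
  assumes "balanced X" "balanced Y" "size X = size Y" "sum_mset X = sum_mset Y"
  shows "X = Y"
proof (cases "X = {#}")
  case False
  have form: "Z = replicate_mset (size Z - \<Sum>\<^sub># Z mod size Z) (\<Sum>\<^sub># Z div size Z)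
      + replicate_mset (\<Sum>\<^sub># Z mod size Z) (\<Sum>\<^sub># Z div size Z + 1)"
    if Z: "balanced Z" "Z \<noteq> {#}" for Z
  proof -
    define k where "k = Min (set_mset Z)"
    define c d where "c = count Z k" and "d = count Z (k + 1)"
    have k: "k \<in># Z" and le: "\<And>z. z \<in># Z \<Longrightarrow> k \<le> z"
      using Z(2) by (auto simp: k_def)
    then have "z = k \<or> z = k + 1" if "z \<in># Z" for z
      using Z(1) that unfolding balanced_def by (metis Suc_eq_plus1 le_SucE le_antisym)
    then have Z': "Z = replicate_mset c k + replicate_mset d (k + 1)"
      by (intro multiset_eqI) (auto simp: c_def d_def count_eq_zero_iff)
    \<comment> \<open>This makes \<open>d < c + d\<close>, so that \<open>d\<close> is indeed the
      remainder.\<close>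
    have "c > 0"
      using k by (simp add: c_def)
    moreover have sz: "size Z = c + d" and "\<Sum>\<^sub># Z = d + k * (c + d)"
      by (subst Z', simp add: algebra_simps)+
    ultimately have "\<Sum>\<^sub># Z div size Z = k" "\<Sum>\<^sub># Z mod size Z = d"
      by simp_all
    then show ?thesis
      using Z' sz by simp
  qed
  have "Y \<noteq> {#}"
    using False assms(3) by auto
  from form[OF assms(2) this] form[OF assms(1) False] assms(3,4) show ?thesis
    by metis
qed (use assms(3) in auto)

text \<open>Moving a unit from \<open>b\<close> to \<open>a\<close> with
  \<open>a + 2 \<le> b\<close> keeps size and sum and lowers the sum of squares, by
  \<open>2 * (b - a - 1)\<close>. Repeating this ends at a balanced multiset, which is
  \<open>X\<close> by uniqueness.\<close>

lemma survivors_balanced_le_same_size: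
  assumes q: "0 \<le> q" "q < 1" and X: "balanced X"
  shows "size X = size Y \<Longrightarrow> \<Sum>\<^sub># X = \<Sum>\<^sub># Y \<Longrightarrow>
    rel_pmf (\<le>) (survivors q X) (survivors q Y)"
proof (induction "\<Sum>y\<in>#Y. y ^ 2" arbitrary: Y rule: less_induct)
  case less
  show ?case
  proof (cases "balanced Y")
    case True
    then show ?thesis
      using balanced_unique[OF X True] less.prems by (auto intro: rel_pmf_reflI)
  next
    case False
    then obtain a b where ab: "a \<in># Y" "b \<in># Y" "a + 2 \<le> b"
      unfolding balanced_def by (auto simp: not_le)
    then obtain Z where Y: "Y = add_mset a (add_mset b Z)"
      by (metis add_eq_self_zero insert_noteq_member le_add1 le_antisym mset_add
          numeral_2_eq_2 old.nat.distinct(1))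
    let ?Y = "add_mset (a + 1) (add_mset (b - 1) Z)"
    obtain d where d: "b = a + 2 + d"
      using ab(3) le_Suc_ex by blast
    have "rel_pmf (\<le>) (survivors q X) (survivors q ?Y)"
      using less.prems by (intro less.hyps) (auto simp: Y d power2_eq_square algebra_simps)
    then show ?thesis
      using survivors_balance[OF q ab(3), of Z] unfolding Y by (rule rel_pmf_le_trans)
  qed
qed

text \<open>Merging two entries of \<open>Y\<close> keeps the sum and lowers the size by one; this
  is repeated until the sizes agree.\<close>

lemma survivors_balanced_le:
  assumes q: "0 \<le> q" "q < 1" and X: "balanced X"
  shows "size X \<le> size Y \<Longrightarrow> \<Sum>\<^sub># X = \<Sum>\<^sub># Y \<Longrightarrow>
    rel_pmf (\<le>) (survivors q X) (survivors q Y)"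
proof (induction "size Y" arbitrary: Y)
  case 0
  then show ?case by (simp add: rel_pmf_reflI)
next
  case (Suc m)
  consider "X = {#}" | "size X = size Y" | "X \<noteq> {#}" "size X \<le> m"
    using Suc by linarith
  then show ?case
  proof cases
    case 1
    then show ?thesis by (simp add: rel_pmf_return_pmf1)
  next
    case 2
    then show ?thesis
      using survivors_balanced_le_same_size[OF q X] Suc.prems by blast
  next
    case 3
    \<comment> \<open>So \<open>Y\<close> has at least two entries, and a merge is possible.\<close>
    then have "m \<noteq> 0"
      by (metis le_zero_eq size_eq_0_iff_empty)
    then obtain a b Z where Y: "Y = add_mset a (add_mset b Z)"
      using Suc.hyps(2) by (metis old.nat.exhaust size_eq_Suc_imp_eq_union nat.inject size_add_mset)
    have "rel_pmf (\<le>) (survivors q X) (survivors q (add_mset (a + b) Z))"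
      using 3 Suc.hyps(2) Suc.prems by (intro Suc.hyps(1)) (auto simp: Y)
    then show ?thesis
      using survivors_merge[OF q] unfolding Y by (rule rel_pmf_le_trans)
  qed
qed

subsection \<open>The Markov chain of active sets\<close>

definition round_pmf :: "real \<Rightarrow> (nat \<Rightarrow> nat) \<Rightarrow> nat set \<Rightarrow> nat set pmf" where
  "round_pmf q x M = map_pmf (\<lambda>b. {i \<in> M. b i}) (Pi_pmf M False (\<lambda>i. bernoulli_pmf (q ^ x i)))"

lemma map_card_round_pmf:
  assumes "finite M"
  shows "map_pmf card (round_pmf q x M) = survivors q (image_mset x (mset_set M))"
  using assms
proof (induction M rule: finite_induct)
  case empty
  then show ?case by (simp add: round_pmf_def)
next
  case (insert i M)
  have "card {j \<in> insert i M. (f(i := b)) j} = of_bool b + card {j \<in> M. f j}" for f b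
  proof -
    have "{j \<in> insert i M. (f(i := b)) j} = (if b then insert i {j \<in> M. f j} else {j \<in> M. f j})"
      using insert.hyps by auto
    then show ?thesis
      using insert.hyps by simp
  qed
  then show ?case
    using insert.hyps by (simp add: round_pmf_def Pi_pmf_insert' insert.IH[symmetric] map_bind_pmf
        pmf.map_comp o_def map_pmf_def bind_assoc_pmf bind_return_pmf)
qed

lemma set_round_pmf: "A \<in> set_pmf (round_pmf q x M) \<Longrightarrow> A \<subseteq> M"
  by (auto simp: round_pmf_def)

lemma fair_balanced:
  assumes "finite M" "fair n C M x"
  shows "balanced (image_mset x (mset_set M))"
proof -
  have "x i \<le> x j + 1" if "i \<in> M" "j \<in> M" for i j
  proof -
    have "\<bar>int (x i) - int (x j)\<bar> \<in> {0, 1}"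
      using assms(2) that unfolding fair_def by blast
    then show ?thesis by auto
  qed
  then show ?thesis
    using assms(1) by (auto simp: balanced_def)
qed

text \<open>A coupling of the cardinalities lifts to one of the sets. The inclusions in the relation
  keep the sets finite when rounds are iterated.\<close>

lemma round_pmf_fair_le:
  assumes "0 \<le> q" "q < 1" "finite M" "finite N" "card M \<le> card N"
    and "fair n C M x" "(\<Sum>i\<in>N. y i) = C"
  shows "rel_pmf (\<lambda>A B. A \<subseteq> M \<and> B \<subseteq> N \<and> card A \<le> card B) (round_pmf q x M) (round_pmf q y N)"
proof -
  have "rel_pmf (\<le>) (map_pmf card (round_pmf q x M)) (map_pmf card (round_pmf q y N))"
    using assms fair_balanced[OF assms(3,6)]
    by (auto simp: map_card_round_pmf fair_def sum_unfold_sum_mset intro!: survivors_balanced_le)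
  then have "rel_pmf (\<lambda>A B. card A \<le> card B) (round_pmf q x M) (round_pmf q y N)"
    by (simp add: pmf.rel_map)
  then show ?thesis
    by (rule pmf.rel_mono_strong) (auto dest: set_round_pmf)
qed

text \<open>The chain for a common \<open>q\<close>, indexed by completed rounds: index
  \<open>t\<close> is the start of round \<open>Suc t\<close>. Demands do not occur here;
  \<open>map_pmf_resid\<close> provides the link.\<close>

primrec active_pmf :: "nat \<Rightarrow> real \<Rightarrow> policy \<Rightarrow> nat \<Rightarrow> nat set pmf" where
  "active_pmf n q \<pi> 0 = return_pmf {1..n}"
| "active_pmf n q \<pi> (Suc t) = active_pmf n q \<pi> t \<bind> (\<lambda>M. round_pmf q (\<pi> (Suc t) M) M)"

lemma set_active_pmf: "M \<in> set_pmf (active_pmf n q \<pi> t) \<Longrightarrow> M \<subseteq> {1..n}"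
  by (induction t arbitrary: M) (simp, fastforce dest: set_round_pmf)

text \<open>The one-round coupling applies to any two sets with \<open>card M \<le> card N\<close>,
  so it can be composed over the rounds although the two chains visit different sets.\<close>

lemma active_pmf_fair_le:
  assumes q: "0 \<le> q" "q < 1" and f: "\<phi> \<in> fair_policies n C" and p: "\<pi> \<in> policies n C"
  shows "rel_pmf (\<lambda>A B. A \<subseteq> {1..n} \<and> B \<subseteq> {1..n} \<and> card A \<le> card B)
    (active_pmf n q \<phi> t) (active_pmf n q \<pi> t)"
proof (induction t)
  case (Suc t)
  show ?case
    unfolding active_pmf.simps
  proof (rule rel_pmf_bindI[OF Suc])
    fix M N
    assume MN: "M \<subseteq> {1..n} \<and> N \<subseteq> {1..n} \<and> card M \<le> card N"
    then have fin: "finite M" "finite N"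
      by (auto intro: finite_subset)
    show "rel_pmf (\<lambda>A B. A \<subseteq> {1..n} \<and> B \<subseteq> {1..n} \<and> card A \<le> card B)
      (round_pmf q (\<phi> (Suc t) M) M) (round_pmf q (\<pi> (Suc t) N) N)"
    \<comment> \<open>Fairness constrains nonempty sets only; from the empty set the chain does not
      move.\<close>
    proof (cases "M = {}")
      case True
      then show ?thesis
        using MN by (auto simp: round_pmf_def rel_pmf_return_pmf1)
    next
      case False
      then have "N \<noteq> {}"
        using MN fin by auto
      then have "fair n C M (\<phi> (Suc t) M)" "(\<Sum>i\<in>N. \<pi> (Suc t) N i) = C"
        using f p MN False by (auto simp: fair_policies_def policies_def)
      from round_pmf_fair_le[OF q fin _ this] MN show ?thesis
        by (auto elim!: pmf.rel_mono_strong)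
    qed
  qed
qed simp

subsection \<open>Demands and their residuals\<close>

text \<open>Truncated residual demands. The active set is read off as their support, so each step
  depends on the current residuals alone and not on the history.\<close>

fun resid :: "policy \<Rightarrow> (nat \<Rightarrow> nat) \<Rightarrow> nat \<Rightarrow> nat \<Rightarrow> nat" where
  "resid \<pi> L 0 = L"
| "resid \<pi> L (Suc t) = (\<lambda>i. resid \<pi> L t i - \<pi> (Suc t) {j. resid \<pi> L t j > 0} i)"

text \<open>Served sums grow with time, so a threat unsatisfied now was unsatisfied before and the
  recursive filter is redundant. Positive demands make the initial set fit the formula.\<close>

lemma active_Suc:
  assumes "\<forall>i\<in>{1..n}. L i > 0"
  shows "active n \<pi> L (Suc t) = {i \<in> {1..n}. (\<Sum>l\<in>{1..t}. alloc n \<pi> L l i) < L i}"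
proof (induction t)
  case 0
  then show ?case using assms by auto
next
  case (Suc t)
  have "active n \<pi> L (Suc (Suc t)) =
      {i \<in> active n \<pi> L (Suc t). (\<Sum>l\<in>{1..Suc t}. alloc n \<pi> L l i) < L i}"
    by (simp only: active.simps alloc_def)
  also have "\<dots> = {i \<in> {1..n}. (\<Sum>l\<in>{1..Suc t}. alloc n \<pi> L l i) < L i}"
    unfolding Suc by (auto simp: sum.cl_ivl_Suc)
  finally show ?case .
qed

text \<open>Successive truncated subtractions amount to one subtraction of the total. Demands
  vanishing outside \<open>{1..n}\<close> make the support of the residuals equal to the active
  set.\<close>

lemma resid_eq:
  assumes "\<forall>i\<in>{1..n}. L i > 0" "\<forall>i. i \<notin> {1..n} \<longrightarrow> L i = 0"
  shows "resid \<pi> L t i = L i - (\<Sum>l\<in>{1..t}. alloc n \<pi> L l i)"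
proof (induction t arbitrary: i)
  case (Suc t)
  have "{j. resid \<pi> L t j > 0} = active n \<pi> L (Suc t)"
  proof -
    have "j \<in> {1..n}" if "L j - (\<Sum>l\<in>{1..t}. alloc n \<pi> L l j) > 0" for j
      using assms(2) that by (metis diff_0_eq_0 less_irrefl)
    then show ?thesis
      unfolding Suc active_Suc[OF assms(1)] by (auto simp del: atLeastAtMost_iff)
  qed
  then show ?case
    by (simp add: Suc alloc_def del: active.simps)
qed simp

lemma set_demands:
  assumes "L \<in> set_pmf (demands n q)"
  shows "\<forall>i\<in>{1..n}. L i > 0" "\<forall>i. i \<notin> {1..n} \<longrightarrow> L i = 0"
  using assms by (auto simp: demands_def set_Pi_pmf PiE_dflt_def)

section \<open>Distribution and mean of the defusing time\<close>

lemma defusing_time_le_iff: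
  assumes "\<tau> \<ge> 1"
  shows "defusing_time n \<pi> L \<le> enat \<tau> \<longleftrightarrow> (\<forall>i\<in>{1..n}. L i \<le> (\<Sum>l\<in>{1..\<tau>}. alloc n \<pi> L l i))"
    (is "_ \<longleftrightarrow> ?P \<tau>")
proof
  let ?S = "{enat t | t. t \<ge> 1 \<and> ?P t}"
  assume *: "defusing_time n \<pi> L \<le> enat \<tau>"
  \<comment> \<open>An empty set would have infimum \<open>\<infinity>\<close>; a nonempty one
    attains its infimum.\<close>
  then have "?S \<noteq> {}"
    unfolding defusing_time_def by (auto simp: Inf_enat_def simp del: Collect_empty_eq)
  then obtain x where "x \<in> ?S"
    by blast
  then have "(LEAST x. x \<in> ?S) \<in> ?S"
    by (rule LeastI)
  moreover have "defusing_time n \<pi> L = (LEAST x. x \<in> ?S)"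
    using \<open>?S \<noteq> {}\<close> by (simp only: defusing_time_def Inf_enat_def if_False)
  ultimately obtain t where t': "defusing_time n \<pi> L = enat t" and P: "?P t"
    by auto
  have "t \<le> \<tau>"
    using * t' by simp
  have "(\<Sum>l\<in>{1..t}. alloc n \<pi> L l i) \<le> (\<Sum>l\<in>{1..\<tau>}. alloc n \<pi> L l i)" for i
    using \<open>t \<le> \<tau>\<close> by (intro sum_mono2) auto
  then show "?P \<tau>"
    using P by (meson order_trans)
next
  assume "?P \<tau>"
  then show "defusing_time n \<pi> L \<le> enat \<tau>"
    unfolding defusing_time_def using assms by (intro Inf_lower) auto
qed

text \<open>The mean of a time with values in \<open>enat\<close> is the sum of its tail
  probabilities, and these are compared term by term.\<close>

lemma DTM_mono:
  assumes "\<And>\<tau>. \<tau> \<ge> 1 \<Longrightarrow> SLM n q \<tau> \<pi> \<le> SLM n q \<tau> \<phi>"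
  shows "DTM n q \<phi> \<le> DTM n q \<pi>"
proof -
  let ?D = "measure_pmf (demands n q)"
  have "emeasure ?D {L. enat t < defusing_time n \<phi> L} \<le> emeasure ?D {L. enat t < defusing_time n \<pi> L}" for t
  \<comment> \<open>The hypothesis starts at \<tau> = 1. At time 0 both tails have probability one,
    as defusing takes at least one round.\<close>
  proof (cases "t = 0")
    case True
    have "enat 0 < defusing_time n \<psi> L" for \<psi> L
    proof -
      have "enat 1 \<le> defusing_time n \<psi> L"
        unfolding defusing_time_def by (intro Inf_greatest) auto
      then show ?thesis
        by (meson enat_ord_simps(2) less_le_trans zero_less_one)
    qed
    then show ?thesis
      using True by simp
  next
    case False
    have "measure ?D {L. enat t < defusing_time n \<psi> L} = 1 - SLM n q t \<psi>" for \<psi>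
      using measure_pmf.prob_compl[of "{L. defusing_time n \<psi> L \<le> enat t}" "demands n q"]
      unfolding SLM_def by (simp add: Compl_eq_Diff_UNIV[symmetric] Collect_neg_eq[symmetric] not_le)
    then show ?thesis
      using assms[of t] False by (simp add: measure_pmf.emeasure_eq_measure ennreal_leI)
  qed
  then show ?thesis
    unfolding DTM_def by (subst (1 2) nn_integral_enat_function) (auto intro!: suminf_le)
qed

section \<open>Memorylessness of the demands\<close>

text \<open>The law of residual demands given the active set \<open>M\<close>. The default 0 marks
  neutralised threats, so \<open>M\<close> can be recovered as the support.\<close>

definition fresh :: "real \<Rightarrow> nat set \<Rightarrow> (nat \<Rightarrow> nat) pmf" where
  "fresh q M = Pi_pmf M 0 (\<lambda>_. map_pmf Suc (geometric_pmf (1 - q)))"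

lemma set_fresh:
  assumes "finite M" "R \<in> set_pmf (fresh q M)"
  shows "{j. R j > 0} = M"
proof -
  have "R j > 0 \<longleftrightarrow> j \<in> M" for j
    using assms by (cases "j \<in> M") (auto simp: fresh_def set_Pi_pmf PiE_dflt_def)
  then show ?thesis by blast
qed

lemma demands_eq_fresh:
  assumes "\<forall>i\<in>{1..n}. q i = c"
  shows "demands n q = fresh c {1..n}"
  unfolding demands_def fresh_def using assms by (intro Pi_pmf_cong) auto

text \<open>Memorylessness: with probability \<open>q ^ k\<close> the threat withstands
  \<open>k\<close> effectors and its residual demand is distributed as at the start; otherwise
  nothing remains.\<close>

lemma geometric_diff:
  assumes "0 \<le> q" "q < 1"
  defines "G \<equiv> map_pmf Suc (geometric_pmf (1 - q))"
  shows "map_pmf (\<lambda>r. r - k) G = bernoulli_pmf (q ^ k) \<bind> (\<lambda>b. if b then G else return_pmf 0)"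
proof (induction k)
  case 0
  then show ?case by (simp add: bernoulli_pmf_1 bind_return_pmf)
next
  case (Suc k)
  have "map_pmf (\<lambda>r. r - 1) G = geometric_pmf (1 - q)"
    by (simp add: G_def pmf.map_comp o_def)
  \<comment> \<open>First-step analysis: a success ends the count at 0, a failure restarts it
    shifted by one, which is \<open>G\<close>.\<close>
  also have "\<dots> = bernoulli_pmf (1 - q) \<bind> (\<lambda>b. if b then return_pmf 0 else G)"
    unfolding G_def using assms by (subst geometric_bind_pmf_unfold) auto
  also have "\<dots> = bernoulli_pmf q \<bind> (\<lambda>b. if b then G else return_pmf 0)"
    using assms by (subst bernoulli_pmf_compl) (auto simp: bind_map_pmf intro!: bind_pmf_cong)
  finally have 1: "map_pmf (\<lambda>r. r - 1) G = \<dots>" .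
  have "map_pmf (\<lambda>r. r - Suc k) G = map_pmf (\<lambda>r. r - 1) (map_pmf (\<lambda>r. r - k) G)"
    by (simp add: pmf.map_comp o_def)
  also have "\<dots> = bernoulli_pmf (q ^ k) \<bind> (\<lambda>b. if b then map_pmf (\<lambda>r. r - 1) G else return_pmf 0)"
    unfolding Suc map_bind_pmf by (intro bind_pmf_cong) auto
  also have "\<dots> = bernoulli_pmf (q ^ k * q) \<bind> (\<lambda>b. if b then G else return_pmf 0)"
    using assms unfolding 1
    by (subst bernoulli_pmf_mult)
       (auto simp: power_le_one bind_assoc_pmf bind_map_pmf bind_return_pmf intro!: bind_pmf_cong)
  finally show ?case by (simp add: mult.commute)
qed

lemma fresh_diff:
  assumes "0 \<le> q" "q < 1" "finite M"
  shows "map_pmf (\<lambda>R i. R i - x i) (fresh q M) = round_pmf q x M \<bind> fresh q"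
proof -
  let ?G = "map_pmf Suc (geometric_pmf (1 - q))"
  have "Pi_pmf M 0 (\<lambda>i. map_pmf (\<lambda>r. r - x i) ?G) =
    fresh q M \<bind> (\<lambda>f. Pi_pmf M 0 (\<lambda>i. return_pmf (f i - x i)))"
    unfolding fresh_def map_pmf_def[of "\<lambda>r. r - x _"] using assms by (intro Pi_pmf_bind)
  also have "\<dots> = map_pmf (\<lambda>R i. R i - x i) (fresh q M)"
    unfolding map_pmf_def using assms
    by (intro bind_pmf_cong) (auto simp: fresh_def set_Pi_pmf PiE_dflt_def fun_eq_iff)
  finally have "map_pmf (\<lambda>R i. R i - x i) (fresh q M) =
    Pi_pmf M 0 (\<lambda>i. bernoulli_pmf (q ^ x i) \<bind> (\<lambda>b. if b then ?G else return_pmf 0))"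
    using assms by (simp add: geometric_diff)
  \<comment> \<open>All survival coins are drawn first; given them, exactly the survivors carry new
    demands.\<close>
  also have "\<dots> = Pi_pmf M False (\<lambda>i. bernoulli_pmf (q ^ x i)) \<bind>
      (\<lambda>b. Pi_pmf M 0 (\<lambda>i. if b i then ?G else return_pmf 0))"
    using assms by (intro Pi_pmf_bind)
  also have "\<dots> = round_pmf q x M \<bind> fresh q"
    using assms by (simp add: round_pmf_def bind_map_pmf fresh_def Pi_pmf_if_set)
  finally show ?thesis .
qed

text \<open>Links the chain to the actual demands: residuals arise by drawing the active set from
  the chain and then independent geometric demands on it.\<close>

lemma map_pmf_resid:
  assumes "0 \<le> q" "q < 1"
  shows "map_pmf (\<lambda>L. resid \<pi> L t) (fresh q {1..n}) = active_pmf n q \<pi> t \<bind> fresh q"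
proof (induction t)
  case (Suc t)
  let ?step = "\<lambda>R i. R i - \<pi> (Suc t) {j. R j > 0} i"
  have "map_pmf (\<lambda>L. resid \<pi> L (Suc t)) (fresh q {1..n}) = active_pmf n q \<pi> t \<bind> (\<lambda>M. map_pmf ?step (fresh q M))"
    unfolding map_bind_pmf[symmetric] Suc[symmetric] by (simp add: pmf.map_comp o_def)
  also have "\<dots> = active_pmf n q \<pi> t \<bind> (\<lambda>M. round_pmf q (\<pi> (Suc t) M) M \<bind> fresh q)"
  proof (intro bind_pmf_cong refl)
    fix M
    assume "M \<in> set_pmf (active_pmf n q \<pi> t)"
    then have M: "finite M"
      using set_active_pmf finite_subset by (metis finite_atLeastAtMost)
    \<comment> \<open>The policy sees only the support, which is \<open>M\<close> for every outcome
      of \<open>fresh q M\<close>, so its allocation is a fixed vector.\<close>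
    have "map_pmf ?step (fresh q M) = map_pmf (\<lambda>R i. R i - \<pi> (Suc t) M i) (fresh q M)"
    proof (intro map_pmf_cong refl)
      fix R
      assume "R \<in> set_pmf (fresh q M)"
      then have "{j. R j > 0} = M"
        using M by (intro set_fresh)
      then show "?step R = (\<lambda>i. R i - \<pi> (Suc t) M i)"
        by simp
    qed
    then show "map_pmf ?step (fresh q M) = round_pmf q (\<pi> (Suc t) M) M \<bind> fresh q"
      using fresh_diff[OF assms M] by simp
  qed
  finally show ?case
    by (simp add: bind_assoc_pmf)
qed (simp add: bind_return_pmf)

subsection \<open>Identical threats\<close>

lemma rel_pmf_nn_integral_le:
  assumes "rel_pmf R p r" "\<And>x y. R x y \<Longrightarrow> f x \<le> g y"
  shows "(\<integral>\<^sup>+x. f x \<partial>measure_pmf p) \<le> (\<integral>\<^sup>+y. g y \<partial>measure_pmf r)"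
proof -
  from assms(1) obtain pr where pr: "\<And>x y. (x, y) \<in> set_pmf pr \<Longrightarrow> R x y"
    "map_pmf fst pr = p" "map_pmf snd pr = r"
    by (auto elim: rel_pmf.cases)
  have "(\<integral>\<^sup>+z. f (fst z) \<partial>measure_pmf pr) \<le> (\<integral>\<^sup>+z. g (snd z) \<partial>measure_pmf pr)"
    by (intro nn_integral_mono_AE) (auto simp: AE_measure_pmf_iff dest!: pr(1) intro: assms(2))
  then show ?thesis
    by (simp flip: pr(2,3))
qed

lemma finished_iff_resid:
  assumes "L \<in> set_pmf (demands n q)" "\<tau> \<ge> 1"
  shows "defusing_time n \<pi> L \<le> enat \<tau> \<longleftrightarrow> {i. resid \<pi> L \<tau> i > 0} = {}"
proof -
  have "resid \<pi> L \<tau> i = L i - (\<Sum>l\<in>{1..\<tau>}. alloc n \<pi> L l i)" for i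
    using set_demands[OF assms(1)] by (intro resid_eq)
  then have "resid \<pi> L \<tau> i > 0 \<longleftrightarrow> i \<in> {1..n} \<and> \<not> L i \<le> (\<Sum>l\<in>{1..\<tau>}. alloc n \<pi> L l i)" for i
    using set_demands(2)[OF assms(1)] by (cases "i \<in> {1..n}") auto
  then show ?thesis
    unfolding defusing_time_le_iff[OF assms(2)] by blast
qed

text \<open>Taking supports in \<open>map_pmf_resid\<close> removes the geometric part and leaves
  the chain.\<close>

lemma SLM_eq_active_pmf:
  assumes "0 \<le> c" "c < 1" "\<forall>i\<in>{1..n}. q i = c" "\<tau> \<ge> 1"
  shows "SLM n q \<tau> \<pi> = measure (active_pmf n c \<pi> \<tau>) {{}}"
proof -
  have "map_pmf (\<lambda>L. {i. resid \<pi> L \<tau> i > 0}) (demands n q)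
      = map_pmf (\<lambda>R. {i. R i > 0}) (map_pmf (\<lambda>L. resid \<pi> L \<tau>) (fresh c {1..n}))"
    by (simp add: pmf.map_comp o_def demands_eq_fresh[OF assms(3)])
  also have "\<dots> = active_pmf n c \<pi> \<tau> \<bind> (\<lambda>M. map_pmf (\<lambda>R. {i. R i > 0}) (fresh c M))"
    unfolding map_pmf_resid[OF assms(1,2)] by (simp add: map_bind_pmf)
  also have "\<dots> = active_pmf n c \<pi> \<tau> \<bind> return_pmf"
  proof (intro bind_pmf_cong refl)
    fix M
    assume "M \<in> set_pmf (active_pmf n c \<pi> \<tau>)"
    then have M: "finite M"
      using set_active_pmf finite_subset by (metis finite_atLeastAtMost)
    have "map_pmf (\<lambda>R. {i. R i > 0}) (fresh c M) = map_pmf (\<lambda>_. M) (fresh c M)"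
      using set_fresh[OF M] by (intro map_pmf_cong) auto
    then show "map_pmf (\<lambda>R. {i. R i > 0}) (fresh c M) = return_pmf M"
      by (simp add: map_pmf_const)
  qed
  finally have *: "map_pmf (\<lambda>L. {i. resid \<pi> L \<tau> i > 0}) (demands n q) = active_pmf n c \<pi> \<tau>"
    by (simp add: bind_return_pmf')
  have "SLM n q \<tau> \<pi> = measure (demands n q) ((\<lambda>L. {i. resid \<pi> L \<tau> i > 0}) -` {{}})"
    unfolding SLM_def using assms(4)
    by (intro measure_pmf.finite_measure_eq_AE) (auto simp: AE_measure_pmf_iff finished_iff_resid)
  then show ?thesis
    by (simp flip: *)
qed

lemma SLM_salvo:
  assumes c: "0 \<le> c" "c < 1" and "\<forall>i\<in>{1..n}. q i = c" "\<tau> \<ge> 1"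
    and "\<phi> \<in> fair_policies n C" "\<pi> \<in> policies n C"
  shows "SLM n q \<tau> \<pi> \<le> SLM n q \<tau> \<phi>"
proof -
  let ?R = "\<lambda>A B. A \<subseteq> {1..n} \<and> B \<subseteq> {1..n} \<and> card A \<le> card B"
  \<comment> \<open>Complements are compared: under the coupling, a nonempty fair set forces the
    other set to be nonempty.\<close>
  have "measure (active_pmf n c \<phi> \<tau>) (- {{}}) \<le> measure (active_pmf n c \<pi> \<tau>) {B. \<exists>A\<in>- {{}}. ?R A B}"
    using active_pmf_fair_le[OF c assms(5,6)] by (rule rel_pmf_measureD)
  also have "\<dots> \<le> measure (active_pmf n c \<pi> \<tau>) (- {{}})"
    by (intro measure_pmf.finite_measure_mono) (auto dest: finite_subset[OF _ finite_atLeastAtMost])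
  finally show ?thesis
    using measure_pmf.prob_compl[of "{{}}" "active_pmf n c \<phi> \<tau>"]
      measure_pmf.prob_compl[of "{{}}" "active_pmf n c \<pi> \<tau>"]
    by (simp add: SLM_eq_active_pmf[OF assms(1-4)] Compl_eq_Diff_UNIV)
qed

section \<open>Mean served demand and mean residual demand\<close>

lemma active_subset: "active n \<pi> L t \<subseteq> {1..n}"
  by (induction n \<pi> L t rule: active.induct) auto

lemma sum_alloc_le:
  assumes "\<pi> \<in> policies n C" "t \<ge> 1"
  shows "(\<Sum>i\<in>{1..n}. alloc n \<pi> L t i) \<le> C"
  using assms active_subset[of n \<pi> L t] by (simp add: policies_def alloc_def)

text \<open>The served demand is bounded by \<open>n * (\<tau> * C)\<close>. Nonnegative integrals
  then allow additivity without further integrability checks.\<close>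

lemma ennreal_EAM:
  assumes "\<pi> \<in> policies n C"
  shows "integrable (demands n q) (\<lambda>L. \<Sum>i\<in>{1..n}. real (min (\<Sum>t\<in>{1..\<tau>}. alloc n \<pi> L t i) (L i)))"
    and "ennreal (EAM n q \<tau> \<pi>) = (\<integral>\<^sup>+L. of_nat (\<Sum>i\<in>{1..n}. min (\<Sum>t\<in>{1..\<tau>}. alloc n \<pi> L t i) (L i))
      \<partial>measure_pmf (demands n q))"
proof -
  have "alloc n \<pi> L t i \<le> C" if "t \<ge> 1" "i \<in> {1..n}" for L t i
    using member_le_sum[OF that(2), of "alloc n \<pi> L t"] sum_alloc_le[OF assms that(1), of L] by simp
  then have "(\<Sum>t\<in>{1..\<tau>}. alloc n \<pi> L t i) \<le> \<tau> * C" if "i \<in> {1..n}" for L i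
    using that sum_bounded_above[of "{1..\<tau>}" "\<lambda>t. alloc n \<pi> L t i" C] by simp
  then have "(\<Sum>i\<in>{1..n}. min (\<Sum>t\<in>{1..\<tau>}. alloc n \<pi> L t i) (L i)) \<le> n * (\<tau> * C)" for L
    using sum_bounded_above[of "{1..n}" "\<lambda>i. min (\<Sum>t\<in>{1..\<tau>}. alloc n \<pi> L t i) (L i)" "\<tau> * C"]
    by (simp add: min.coboundedI1)
  then have "norm (\<Sum>i\<in>{1..n}. real (min (\<Sum>t\<in>{1..\<tau>}. alloc n \<pi> L t i) (L i))) \<le> real (n * (\<tau> * C))" for L
    by (simp flip: of_nat_sum del: of_nat_mult)
  then show int: "integrable (demands n q) (\<lambda>L. \<Sum>i\<in>{1..n}. real (min (\<Sum>t\<in>{1..\<tau>}. alloc n \<pi> L t i) (L i)))"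
    by (intro measure_pmf.integrable_const_bound) auto
  show "ennreal (EAM n q \<tau> \<pi>) = (\<integral>\<^sup>+L. of_nat (\<Sum>i\<in>{1..n}. min (\<Sum>t\<in>{1..\<tau>}. alloc n \<pi> L t i) (L i))
      \<partial>measure_pmf (demands n q))"
    unfolding EAM_def
    by (subst nn_integral_eq_integral[OF int, symmetric])
       (auto simp: ennreal_of_nat_eq_real_of_nat simp flip: of_nat_sum intro!: sum_nonneg)
qed

lemma fresh_mean_finite:
  assumes "0 \<le> q" "q < 1"
  shows "(\<integral>\<^sup>+r. of_nat r \<partial>measure_pmf (map_pmf Suc (geometric_pmf (1 - q)))) < \<infinity>"
proof -
  have "integrable (geometric_pmf (1 - q)) real"
    using assms by (intro integrable_real_geometric_pmf) auto
  then have "integrable (geometric_pmf (1 - q)) (\<lambda>r. real (Suc r))"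
    by simp
  from nn_integral_eq_integral[OF this] show ?thesis
    by (simp add: ennreal_of_nat_eq_real_of_nat del: of_nat_Suc)
qed

lemma nn_integral_fresh:
  assumes "M \<subseteq> {1..n}"
  shows "(\<integral>\<^sup>+R. of_nat (\<Sum>i\<in>{1..n}. R i) \<partial>measure_pmf (fresh q M))
     = of_nat (card M) * (\<integral>\<^sup>+r. of_nat r \<partial>measure_pmf (map_pmf Suc (geometric_pmf (1 - q))))"
    (is "_ = _ * ?m")
proof -
  have fin: "finite M"
    using assms by (rule finite_subset) simp
  have "(\<integral>\<^sup>+R. of_nat (R i) \<partial>measure_pmf (fresh q M)) = (if i \<in> M then ?m else 0)" for i
  proof -
    have "(\<integral>\<^sup>+R. of_nat (R i) \<partial>measure_pmf (fresh q M))
        = (\<integral>\<^sup>+r. of_nat r \<partial>measure_pmf (map_pmf (\<lambda>R. R i) (fresh q M)))"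
      by simp
    then show ?thesis
      unfolding fresh_def Pi_pmf_component[OF fin] by auto
  qed
  then have "(\<integral>\<^sup>+R. of_nat (\<Sum>i\<in>{1..n}. R i) \<partial>measure_pmf (fresh q M)) = (\<Sum>i\<in>{1..n}. if i \<in> M then ?m else 0)"
    by (simp add: nn_integral_sum)
  then show ?thesis
    using assms by (simp add: sum.If_cases Int_absorb1)
qed

text \<open>Served plus residual demand is \<open>L i\<close> pointwise, and the mean residual is
  \<open>m\<close> per active threat. The right-hand side is the same for all policies, so serving
  more means keeping fewer threats active on average.\<close>

lemma EAM_resid:
  assumes c: "0 \<le> c" "c < 1" and q: "\<forall>i\<in>{1..n}. q i = c" and "\<pi> \<in> policies n C"
  defines "m \<equiv> \<integral>\<^sup>+r. of_nat r \<partial>measure_pmf (map_pmf Suc (geometric_pmf (1 - c)))"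
  shows "ennreal (EAM n q \<tau> \<pi>) + (\<integral>\<^sup>+M. of_nat (card M) * m \<partial>measure_pmf (active_pmf n c \<pi> \<tau>)) = of_nat n * m"
proof -
  have "(\<integral>\<^sup>+M. of_nat (card M) * m \<partial>measure_pmf (active_pmf n c \<pi> \<tau>))
      = (\<integral>\<^sup>+R. of_nat (\<Sum>i\<in>{1..n}. R i) \<partial>measure_pmf (active_pmf n c \<pi> \<tau> \<bind> fresh c))"
    unfolding nn_integral_bind_pmf m_def
    by (intro nn_integral_cong_AE, unfold AE_measure_pmf_iff)
       (metis nn_integral_fresh[OF set_active_pmf])
  also have "\<dots> = (\<integral>\<^sup>+L. of_nat (\<Sum>i\<in>{1..n}. resid \<pi> L \<tau> i) \<partial>measure_pmf (demands n q))"
    by (simp add: map_pmf_resid[OF c, symmetric] demands_eq_fresh[OF q])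
  also have "ennreal (EAM n q \<tau> \<pi>) + \<dots> = (\<integral>\<^sup>+L. of_nat (\<Sum>i\<in>{1..n}. L i) \<partial>measure_pmf (demands n q))"
    unfolding ennreal_EAM(2)[OF assms(4)]
  proof (subst nn_integral_add[symmetric], simp, simp, intro nn_integral_cong_AE, unfold AE_measure_pmf_iff, intro ballI)
    fix L
    assume L: "L \<in> set_pmf (demands n q)"
    have "min (\<Sum>t\<in>{1..\<tau>}. alloc n \<pi> L t i) (L i) + resid \<pi> L \<tau> i = L i" for i
      using resid_eq[OF set_demands[OF L], of \<pi> \<tau> i] by simp
    then show "(of_nat (\<Sum>i\<in>{1..n}. min (\<Sum>t\<in>{1..\<tau>}. alloc n \<pi> L t i) (L i)) :: ennreal)
       + of_nat (\<Sum>i\<in>{1..n}. resid \<pi> L \<tau> i) = of_nat (\<Sum>i\<in>{1..n}. L i)"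
      by (simp flip: sum.distrib of_nat_add of_nat_sum)
  qed
  also have "\<dots> = of_nat n * m"
    unfolding demands_eq_fresh[OF q] m_def nn_integral_fresh[OF order_refl] by simp
  finally show ?thesis .
qed

lemma EAM_salvo:
  assumes c: "0 \<le> c" "c < 1" and q: "\<forall>i\<in>{1..n}. q i = c"
    and f: "\<phi> \<in> fair_policies n C" and p: "\<pi> \<in> policies n C"
  shows "EAM n q \<tau> \<pi> \<le> EAM n q \<tau> \<phi>"
proof -
  define m where "m = (\<integral>\<^sup>+r. of_nat r \<partial>measure_pmf (map_pmf Suc (geometric_pmf (1 - c))))"
  let ?B = "\<lambda>\<psi>. \<integral>\<^sup>+M. of_nat (card M) * m \<partial>measure_pmf (active_pmf n c \<psi> \<tau>)"
  have f': "\<phi> \<in> policies n C"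
    using f by (simp add: fair_policies_def)
  have "ennreal (EAM n q \<tau> \<pi>) + ?B \<pi> = ennreal (EAM n q \<tau> \<phi>) + ?B \<phi>"
    using EAM_resid[OF c q p, of \<tau>] EAM_resid[OF c q f', of \<tau>] unfolding m_def by simp
  also have "?B \<phi> \<le> ?B \<pi>"
    by (rule rel_pmf_nn_integral_le[OF active_pmf_fair_le[OF c f p]]) (auto intro!: mult_right_mono)
  finally have "?B \<pi> + ennreal (EAM n q \<tau> \<pi>) \<le> ?B \<pi> + ennreal (EAM n q \<tau> \<phi>)"
    by (simp add: add.commute)
  \<comment> \<open>Cancellation in \<open>ennreal\<close> requires a finite term; the geometric
    mean is finite.\<close>
  moreover have "?B \<pi> \<noteq> \<infinity>"
  proof -
    have "?B \<pi> \<le> of_nat n * m"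
      using EAM_resid[OF c q p, of \<tau>] unfolding m_def by (metis le_add2 zero_le add.commute add_increasing2 order_refl)
    also have "\<dots> < \<infinity>"
      using fresh_mean_finite[OF c] by (simp add: m_def ennreal_mult_less_top of_nat_less_top)
    finally show ?thesis by simp
  qed
  ultimately have "ennreal (EAM n q \<tau> \<pi>) \<le> ennreal (EAM n q \<tau> \<phi>)"
    by (simp add: ennreal_add_left_cancel_le)
  moreover have "0 \<le> EAM n q \<tau> \<phi>"
    unfolding EAM_def by (intro Bochner_Integration.integral_nonneg) (auto intro!: sum_nonneg)
  ultimately show ?thesis by simp
qed

subsection \<open>Capacity at most two\<close>

lemma sum_alloc_fair:
  assumes "\<phi> \<in> fair_policies n C" "t \<ge> 1" "active n \<phi> L t \<noteq> {}"
  shows "fair n C (active n \<phi> L t) (alloc n \<phi> L t)"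
    and "(\<Sum>i\<in>{1..n}. alloc n \<phi> L t i) = C"
proof -
  have x: "alloc n \<phi> L t = \<phi> t (active n \<phi> L t)"
    by (simp add: alloc_def fun_eq_iff)
  show fair: "fair n C (active n \<phi> L t) (alloc n \<phi> L t)"
    unfolding x using assms active_subset[of n \<phi> L t] by (simp add: fair_policies_def)
  have "(\<Sum>i\<in>{1..n}. alloc n \<phi> L t i) = (\<Sum>i\<in>active n \<phi> L t. alloc n \<phi> L t i)"
    using fair active_subset[of n \<phi> L t] by (intro sum.mono_neutral_right) (auto simp: fair_def)
  then show "(\<Sum>i\<in>{1..n}. alloc n \<phi> L t i) = C"
    using fair by (simp add: fair_def)
qed

lemma active_antimono:
  assumes "1 \<le> s" "s \<le> t"
  shows "active n \<pi> L t \<subseteq> active n \<pi> L s"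
  using assms(2)
proof (induction t rule: dec_induct)
  case (step t)
  then obtain u where "t = Suc u"
    using assms(1) by (cases t) auto
  then show ?case
    using step by auto
qed simp

text \<open>One unit given to an active threat is never wasted. A fair allocation with
  \<open>C \<le> 2\<close> gives two units only to a sole active threat; as some threat remains
  active afterwards, it is that one, and its demand was not exceeded.\<close>

lemma fair_two_no_waste:
  assumes \<phi>: "\<phi> \<in> fair_policies n C" and C: "C \<le> 2" and L: "\<forall>i\<in>{1..n}. L i > 0"
  shows "active n \<phi> L (Suc t) \<noteq> {} \<Longrightarrow> i \<in> {1..n} \<Longrightarrow> (\<Sum>l\<in>{1..t}. alloc n \<phi> L l i) \<le> L i"
proof (induction t arbitrary: i)
  case (Suc t)
  let ?M = "active n \<phi> L (Suc t)" and ?x = "alloc n \<phi> L (Suc t)"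
  have M: "active n \<phi> L (Suc (Suc t)) = {i \<in> ?M. (\<Sum>l\<in>{1..Suc t}. alloc n \<phi> L l i) < L i}"
    by (simp only: active.simps alloc_def)
  then have ne: "?M \<noteq> {}"
    using Suc.prems by blast
  have fin: "finite ?M"
    using active_subset finite_subset by (metis finite_atLeastAtMost)
  note fair = sum_alloc_fair(1)[OF \<phi> _ ne, simplified, unfolded fair_def]
  have IH: "(\<Sum>l\<in>{1..t}. alloc n \<phi> L l i) \<le> L i"
    using Suc.IH ne Suc.prems(2) by blast
  consider "i \<notin> ?M" | "i \<in> ?M" "?x i \<le> 1" | "i \<in> ?M" "?x i \<ge> 2"
    by linarith
  then show ?case
  proof cases
    case 1
    then have "?x i = 0"
      using fair Suc.prems(2) by auto
    then show ?thesis
      using IH by (simp add: sum.cl_ivl_Suc)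
  next
    case 2
    then show ?thesis
      unfolding active_Suc[OF L] by (simp add: sum.cl_ivl_Suc)
  next
    case 3
    have "j = i" if "j \<in> ?M" for j
    proof (rule ccontr)
      assume "j \<noteq> i"
      have "?x i + ?x j = (\<Sum>k\<in>{i, j}. ?x k)"
        using \<open>j \<noteq> i\<close> by simp
      also have "\<dots> \<le> (\<Sum>k\<in>?M. ?x k)"
        using fin 3 that by (intro sum_mono2) auto
      finally have "?x j = 0" "?x i = 2"
        using fair C 3 by auto
      moreover have "\<bar>int (?x i) - int (?x j)\<bar> \<in> {0, 1}"
        using fair 3 that by blast
      ultimately show False by simp
    qed
    then have "i \<in> active n \<phi> L (Suc (Suc t))"
      using Suc.prems(1) unfolding M by blast
    then show ?thesis
      unfolding M by simp
  qed
qed simp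

context
  fixes n C :: nat and \<phi> \<pi> :: policy and L :: "nat \<Rightarrow> nat" and \<tau> :: nat
  assumes \<phi>: "\<phi> \<in> fair_policies n C" and \<pi>: "\<pi> \<in> policies n C" and C: "C \<le> 2"
    and L: "\<forall>i\<in>{1..n}. L i > 0"
begin

lemma fair_two_unfinished:
  assumes "active n \<phi> L (Suc \<tau>) \<noteq> {}"
  shows "\<forall>i\<in>{1..n}. (\<Sum>l\<in>{1..\<tau>}. alloc n \<phi> L l i) \<le> L i"
    and "(\<Sum>i\<in>{1..n}. \<Sum>l\<in>{1..\<tau>}. alloc n \<pi> L l i)
      \<le> (\<Sum>i\<in>{1..n}. \<Sum>l\<in>{1..\<tau>}. alloc n \<phi> L l i)"
proof -
  show "\<forall>i\<in>{1..n}. (\<Sum>l\<in>{1..\<tau>}. alloc n \<phi> L l i) \<le> L i"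
    using fair_two_no_waste[OF \<phi> C L assms] by blast
  \<comment> \<open>Active sets shrink, so the set is nonempty in every round up to \<tau> and the
    fair policy spends all of \<open>C\<close> on active threats.\<close>
  have full: "(\<Sum>i\<in>{1..n}. alloc n \<phi> L l i) = C" if "l \<in> {1..\<tau>}" for l
    using that assms active_antimono[of l "Suc \<tau>" n \<phi> L] by (intro sum_alloc_fair[OF \<phi>]) auto
  have "(\<Sum>l\<in>{1..\<tau>}. \<Sum>i\<in>{1..n}. alloc n \<pi> L l i)
      \<le> (\<Sum>l\<in>{1..\<tau>}. \<Sum>i\<in>{1..n}. alloc n \<phi> L l i)"
    using sum_alloc_le[OF \<pi>] by (intro sum_mono[of "{1..\<tau>}"]) (simp only: full atLeastAtMost_iff)
  then show "(\<Sum>i\<in>{1..n}. \<Sum>l\<in>{1..\<tau>}. alloc n \<pi> L l i)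
      \<le> (\<Sum>i\<in>{1..n}. \<Sum>l\<in>{1..\<tau>}. alloc n \<phi> L l i)"
    by (simp only: sum.swap[of _ "{1..\<tau>}"])
qed

text \<open>If the fair policy were unfinished, its total allocation would lie strictly below the
  total demand, yet be at least that of a policy that has met all demands.\<close>

lemma fair_two_faster:
  assumes "\<tau> \<ge> 1" "defusing_time n \<pi> L \<le> enat \<tau>"
  shows "defusing_time n \<phi> L \<le> enat \<tau>"
proof (rule ccontr)
  assume "\<not> defusing_time n \<phi> L \<le> enat \<tau>"
  then obtain i where i: "i \<in> {1..n}" "(\<Sum>l\<in>{1..\<tau>}. alloc n \<phi> L l i) < L i"
    unfolding defusing_time_le_iff[OF assms(1)] by (auto simp: not_le)
  then have ne: "active n \<phi> L (Suc \<tau>) \<noteq> {}"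
    unfolding active_Suc[OF L] by blast
  have "(\<Sum>i\<in>{1..n}. L i) \<le> (\<Sum>i\<in>{1..n}. \<Sum>l\<in>{1..\<tau>}. alloc n \<pi> L l i)"
    using assms(2) unfolding defusing_time_le_iff[OF assms(1)] by (intro sum_mono) blast
  also have "\<dots> \<le> (\<Sum>i\<in>{1..n}. \<Sum>l\<in>{1..\<tau>}. alloc n \<phi> L l i)"
    by (rule fair_two_unfinished(2)[OF ne])
  also have "\<dots> < (\<Sum>i\<in>{1..n}. L i)"
    using fair_two_unfinished(1)[OF ne] i by (intro sum_strict_mono_ex1) auto
  finally show False by simp
qed

text \<open>Either the fair policy has met every demand in full, or nothing it allocated was wasted
  and no policy allocates more.\<close>

lemma fair_two_more:
  "(\<Sum>i\<in>{1..n}. min (\<Sum>t\<in>{1..\<tau>}. alloc n \<pi> L t i) (L i))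
    \<le> (\<Sum>i\<in>{1..n}. min (\<Sum>t\<in>{1..\<tau>}. alloc n \<phi> L t i) (L i))"
proof (cases "active n \<phi> L (Suc \<tau>) = {}")
  case True
  then show ?thesis
    unfolding active_Suc[OF L] by (intro sum_mono) (auto simp: not_less min_absorb2)
next
  case False
  have "(\<Sum>i\<in>{1..n}. min (\<Sum>t\<in>{1..\<tau>}. alloc n \<pi> L t i) (L i))
      \<le> (\<Sum>i\<in>{1..n}. \<Sum>l\<in>{1..\<tau>}. alloc n \<pi> L l i)"
    by (intro sum_mono) simp
  also have "\<dots> \<le> (\<Sum>i\<in>{1..n}. \<Sum>l\<in>{1..\<tau>}. alloc n \<phi> L l i)"
    by (rule fair_two_unfinished(2)[OF False])
  also have "\<dots> = (\<Sum>i\<in>{1..n}. min (\<Sum>t\<in>{1..\<tau>}. alloc n \<phi> L t i) (L i))"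
    using fair_two_unfinished(1)[OF False] by (intro sum.cong) (auto simp: min_absorb1)
  finally show ?thesis .
qed

end

lemma SLM_two:
  assumes "\<phi> \<in> fair_policies n C" "\<pi> \<in> policies n C" "C \<le> 2" "\<tau> \<ge> 1"
  shows "SLM n q \<tau> \<pi> \<le> SLM n q \<tau> \<phi>"
  unfolding SLM_def
  by (rule measure_pmf.finite_measure_mono_AE)
     (auto simp: AE_measure_pmf_iff intro: fair_two_faster[OF assms(1-3) set_demands(1) assms(4)])

lemma EAM_two:
  assumes "\<phi> \<in> fair_policies n C" "\<pi> \<in> policies n C" "C \<le> 2"
  shows "EAM n q \<tau> \<pi> \<le> EAM n q \<tau> \<phi>"
proof -
  have "\<phi> \<in> policies n C"
    using assms(1) by (simp add: fair_policies_def)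
  moreover have "AE L in measure_pmf (demands n q).
      (\<Sum>i\<in>{1..n}. real (min (\<Sum>t\<in>{1..\<tau>}. alloc n \<pi> L t i) (L i)))
      \<le> (\<Sum>i\<in>{1..n}. real (min (\<Sum>t\<in>{1..\<tau>}. alloc n \<phi> L t i) (L i)))"
    unfolding AE_measure_pmf_iff of_nat_sum[symmetric] of_nat_le_iff
    using fair_two_more[OF assms set_demands(1)] by blast
  ultimately show ?thesis
    unfolding EAM_def using ennreal_EAM(1) assms(2) by (intro integral_mono_AE) blast+
qed

theorem theorem2:
  fixes n C \<tau> :: nat and q :: "nat \<Rightarrow> real" and \<pi> :: policy
  assumes "n \<ge> 1" and "C \<ge> 1" and "\<tau> \<ge> 1"
    and "\<forall>i\<in>{1..n}. 0 \<le> q i \<and> q i < 1"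
    and "(\<forall>i\<in>{1..n}. \<forall>j\<in>{1..n}. q i = q j) \<or> C \<le> 2"
    and "\<pi> \<in> fair_policies n C"
  shows "is_arg_min (DTM n q) (\<lambda>\<pi>. \<pi> \<in> policies n C) \<pi>
       \<and> is_arg_max (SLM n q \<tau>) (\<lambda>\<pi>. \<pi> \<in> policies n C) \<pi>
       \<and> is_arg_max (EAM n q \<tau>) (\<lambda>\<pi>. \<pi> \<in> policies n C) \<pi>"
proof -
  \<comment> \<open>The horizon \<open>t\<close> is kept arbitrary in the first inequality because
    \<open>DTM_mono\<close> uses all horizons.\<close>
  have le: "SLM n q t \<psi> \<le> SLM n q t \<pi>" "EAM n q \<tau> \<psi> \<le> EAM n q \<tau> \<pi>"
    if \<psi>: "\<psi> \<in> policies n C" and t: "t \<ge> 1" for \<psi> t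
  proof -
    have "SLM n q t \<psi> \<le> SLM n q t \<pi> \<and> EAM n q \<tau> \<psi> \<le> EAM n q \<tau> \<pi>"
    proof (cases "C \<le> 2")
      case True
      then show ?thesis
        using SLM_two EAM_two assms(6) \<psi> t by blast
    next
      case False
      have "1 \<in> {1..n}"
        using assms(1) by simp
      then have "\<forall>i\<in>{1..n}. q i = q 1" "0 \<le> q 1" "q 1 < 1"
        using assms(4,5) False by blast+
      then show ?thesis
        using SLM_salvo EAM_salvo assms(6) \<psi> t by blast
    qed
    then show "SLM n q t \<psi> \<le> SLM n q t \<pi>" "EAM n q \<tau> \<psi> \<le> EAM n q \<tau> \<pi>"
      by simp_all
  qed
  have "\<pi> \<in> policies n C"
    using assms(6) by (simp add: fair_policies_def)
  moreover have "DTM n q \<pi> \<le> DTM n q \<psi>" if "\<psi> \<in> policies n C" for \<psi>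
    using le(1)[OF that] by (rule DTM_mono)
  ultimately show ?thesis
    using le assms(3) by (auto simp: is_arg_min_def is_arg_max_def not_less)
qed

end
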